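(* Let $\mathcal H_A,\mathcal H_B$ be finite-dimensional Hilbert spaces, let $\rho_{AB}$ be a sub-normalized state on $\mathcal H_A\otimes\mathcal H_B$ (a positive semi-definite operator with $\mathrm{tr}[\rho_{AB}]\le 1$), and suppose that $\mathcal H_A$ admits a full set of $|A|+1$ mutually unbiased bases $\{|\theta_k\rangle\}_{k=1}^{|A|}$, $\theta=1,\dots,|A|+1$. Then $$H_2(K|B\Theta)_\rho=\log(|A|+1)-\log\left(2^{-H_2(A|B)_\rho}+1\right),$$ where the left-hand side is evaluated on the state $$\rho_{KB\Theta}=\frac{1}{|A|+1}\sum_{\theta=1}^{|A|+1}\sum_{k=1}^{|A|}\left(|\theta_k\rangle\langle\theta_k|\otimes 1_B\right)\rho_{AB}\left(|\theta_k\rangle\langle\theta_k|\otimes 1_B\right)\otimes|\theta\rangle\langle\theta|_\Theta .$$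
   Context: $|A|=\dim\mathcal H_A$ and all logarithms are base 2. Orthonormal bases $\{|\theta_k\rangle\}_k$ of $\mathcal H_A$ indexed by $\theta$ are mutually unbiased if $|\langle\theta_k|\theta'_{k'}\rangle|=1/\sqrt{|A|}$ for all $k,k'$ and all $\theta\neq\theta'$. The vectors $|\theta\rangle_\Theta$ form an orthonormal basis of an auxiliary space $\mathcal H_\Theta$ of dimension $|A|+1$; the system $K$ is the measured system $A$. For a positive semi-definite operator $\rho_{AB}$ on $\mathcal H_A\otimes\mathcal H_B$, the conditional Rényi 2-entropy of $A$ given $B$ is $$H_2(A|B)_\rho=-\log\mathrm{tr}\left[\rho_{AB}(1_A\otimes\rho_B)^{-1/2}\rho_{AB}(1_A\otimes\rho_B)^{-1/2}\right],$$ where $\rho_B=\mathrm{tr}_A\rho_{AB}$ and inverses are generalized inverses (taken on the support). $H_2(K|B\Theta)$ is the same quantity for the system $K$ with conditioning system $B\Theta$.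
   Formalization: The printed formula fails when tr[ρ_AB] < 1: the "1" added to 2^{-H_2(A|B)} in the last logarithm is replaced by tr[ρ_AB], giving the printed formula exactly when tr[ρ_AB] = 1; ρ_AB = 0 is excluded because its entropy is undefined. *)

theory Defs
  imports "HOL-Analysis.Analysis"
begin

(* A Hilbert space with an orthonormal reference basis indexed by a finite type 'n is complex^'n,
   its dimension is CARD('n), and the tensor product of complex^'m and complex^'n is
   complex^('m * 'n).  Inner products are conjugate-linear in the first argument. *)

definition braket :: "complex^'n \<Rightarrow> complex^'n \<Rightarrow> complex" where
  "braket u v = (\<Sum>i\<in>UNIV. cnj (u $ i) * v $ i)"

definition dagger :: "complex^'n^'m \<Rightarrow> complex^'m^'n" where
  "dagger M = map_matrix cnj (transpose M)"

definition unitary_mat :: "complex^'n^'n \<Rightarrow> bool" where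
  "unitary_mat U \<longleftrightarrow> dagger U ** U = mat 1 \<and> U ** dagger U = mat 1"

definition psd_mat :: "complex^'n^'n \<Rightarrow> bool" where
  "psd_mat M \<longleftrightarrow> dagger M = M \<and> (\<forall>v. 0 \<le> Re (braket v (M *v v)))"

definition real_diag :: "('n \<Rightarrow> real) \<Rightarrow> complex^'n^'n" where
  "real_diag d = (\<chi> i j. if i = j then of_real (d i) else 0)"

(* Spectral functional calculus.  It is meaningful for Hermitian M only; the value does not depend
   on the chosen diagonalization, see herm_fun_eq below. *)
definition herm_fun :: "(real \<Rightarrow> real) \<Rightarrow> complex^'n^'n \<Rightarrow> complex^'n^'n" where
  "herm_fun f M = (THE X. \<exists>U d. unitary_mat U \<and> M = U ** real_diag d ** dagger U
                              \<and> X = U ** real_diag (f \<circ> d) ** dagger U)"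

(* The generalized inverse square root: the eigenvalue 0 is sent to 0. *)
definition gen_inv_sqrt :: "complex^'n^'n \<Rightarrow> complex^'n^'n" where
  "gen_inv_sqrt M = herm_fun (\<lambda>x. if x = 0 then 0 else x powr (- 1 / 2)) M"

definition kron :: "complex^'m^'m \<Rightarrow> complex^'n^'n \<Rightarrow> complex^('m::finite \<times> 'n::finite)^('m \<times> 'n)"
    (infixr "\<otimes>\<^sub>k" 75) where
  "M \<otimes>\<^sub>k N = (\<chi> p q. M $ fst p $ fst q * N $ snd p $ snd q)"

definition ptrace_fst :: "complex^('m::finite \<times> 'n::finite)^('m \<times> 'n) \<Rightarrow> complex^'n^'n" where
  "ptrace_fst M = (\<chi> i j. \<Sum>a\<in>UNIV. M $ (a, i) $ (a, j))"

definition proj :: "complex^'n \<Rightarrow> complex^'n^'n" where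
  "proj v = (\<chi> i j. v $ i * cnj (v $ j))"

(* The canonical identification of (A \<otimes> B) \<otimes> C with A \<otimes> (B \<otimes> C). *)
definition reassoc ::
  "complex^(('a::finite \<times> 'b::finite) \<times> 'c::finite)^(('a \<times> 'b) \<times> 'c) \<Rightarrow> complex^('a \<times> 'b \<times> 'c)^('a \<times> 'b \<times> 'c)" where
  "reassoc M = (\<chi> p q. M $ ((fst p, fst (snd p)), snd (snd p)) $ ((fst q, fst (snd q)), snd (snd q)))"

(* H_2(A|B) for the bipartition whose first factor is A.  The trace is real and, for a nonzero
   positive semi-definite operator, positive; the entropy is meaningful only in that case. *)
definition cond_entropy2 :: "complex^('a::finite \<times> 'b::finite)^('a \<times> 'b) \<Rightarrow> real" where
  "cond_entropy2 \<rho> =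
     (let S = gen_inv_sqrt (mat 1 \<otimes>\<^sub>k ptrace_fst \<rho>)
      in - log 2 (Re (trace (\<rho> ** S ** \<rho> ** S))))"

(* As many orthonormal vectors as the dimension, hence an orthonormal basis. *)
definition onb :: "('n \<Rightarrow> complex^'n) \<Rightarrow> bool" where
  "onb v \<longleftrightarrow> (\<forall>k l. braket (v k) (v l) = (if k = l then 1 else 0))"

definition mubs :: "('t \<Rightarrow> 'a \<Rightarrow> complex^'a) \<Rightarrow> bool" where
  "mubs \<phi> \<longleftrightarrow> (\<forall>\<theta>. onb (\<phi> \<theta>)) \<and>
     (\<forall>\<theta> \<theta>'. \<theta> \<noteq> \<theta>' \<longrightarrow>
        (\<forall>k k'. cmod (braket (\<phi> \<theta> k) (\<phi> \<theta>' k')) = 1 / sqrt (real CARD('a))))"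

(* The state on K B Theta; e is the orthonormal basis of the register Theta. *)
definition post_meas_state ::
  "('t \<Rightarrow> 'a \<Rightarrow> complex^'a) \<Rightarrow> ('t \<Rightarrow> complex^'t) \<Rightarrow>
     complex^('a::finite \<times> 'b::finite)^('a \<times> 'b) \<Rightarrow> complex^('a \<times> 'b \<times> 't)^('a \<times> 'b \<times> 't)" where
  "post_meas_state \<phi> e \<rho> =
     (1 / real (CARD('a) + 1)) *\<^sub>R
       (\<Sum>\<theta>\<in>UNIV. \<Sum>k\<in>UNIV.
          reassoc (((proj (\<phi> \<theta> k) \<otimes>\<^sub>k mat 1) ** \<rho> ** (proj (\<phi> \<theta> k) \<otimes>\<^sub>k mat 1))
                     \<otimes>\<^sub>k proj (e \<theta>)))"

lemma real_diag_intertwine: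
  fixes W :: "complex^'n^'n"
  assumes "W ** real_diag d = real_diag e ** W"
  shows "W ** real_diag (f \<circ> d) = real_diag (f \<circ> e) ** W"
proof -
  have mult: "(W ** real_diag g) $ i $ j = W $ i $ j * of_real (g j)"
    "(real_diag g ** W) $ i $ j = of_real (g i) * W $ i $ j" for g i j
    by (simp_all add: matrix_matrix_mult_def real_diag_def if_distrib if_distribR cong: if_cong)
  have "W $ i $ j * of_real (d j) = of_real (e i) * W $ i $ j" for i j
    using assms mult by metis
  then have "W $ i $ j = 0 \<or> d j = e i" for i j
    by (metis mult.commute mult_cancel_left of_real_eq_iff)
  then show ?thesis
    by (simp add: vec_eq_iff mult) (metis mult_zero_left mult_zero_right mult.commute)
qed

lemma herm_fun_eq:
  assumes U: "unitary_mat U" and M: "M = U ** real_diag d ** dagger U"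
  shows "herm_fun f M = U ** real_diag (f \<circ> d) ** dagger U"
  unfolding herm_fun_def
proof (rule the_equality)
  fix X
  assume "\<exists>V e. unitary_mat V \<and> M = V ** real_diag e ** dagger V
                  \<and> X = V ** real_diag (f \<circ> e) ** dagger V"
  then obtain V e where V: "unitary_mat V" and e: "M = V ** real_diag e ** dagger V"
    and X: "X = V ** real_diag (f \<circ> e) ** dagger V" by blast
  note u = U[unfolded unitary_mat_def] V[unfolded unitary_mat_def]
  have "dagger V ** U ** real_diag d = dagger V ** (U ** real_diag d ** dagger U) ** U"
    using u by (metis matrix_mul_assoc matrix_mul_rid)
  also have "\<dots> = dagger V ** (V ** real_diag e ** dagger V) ** U"
    using M e by simp
  also have "\<dots> = real_diag e ** (dagger V ** U)"
    using u by (metis matrix_mul_assoc matrix_mul_lid)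
  finally have W: "dagger V ** U ** real_diag (f \<circ> d) = real_diag (f \<circ> e) ** (dagger V ** U)"
    by (rule real_diag_intertwine)
  have "X = V ** (real_diag (f \<circ> e) ** (dagger V ** U)) ** dagger U"
    using u X by (metis matrix_mul_assoc matrix_mul_rid)
  also have "\<dots> = V ** (dagger V ** U ** real_diag (f \<circ> d)) ** dagger U"
    by (simp only: W)
  also have "\<dots> = U ** real_diag (f \<circ> d) ** dagger U"
    using u by (metis matrix_mul_assoc matrix_mul_lid)
  finally show "X = U ** real_diag (f \<circ> d) ** dagger U" .
qed (use U M in blast)

end

theory Submission
  imports Defs
begin

text \<open>
  Both sides reduce to traces of the form \<open>tr(X S X S)\<close> with \<open>S = \<rho>\<^sub>B\<^sup>-\<^sup>1\<^sup>/\<^sup>2\<close>. The marginal of the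
  measured state on \<open>B\<Theta>\<close> is \<open>\<rho>\<^sub>B \<otimes> 1 / (|A|+1)\<close>, so orthogonality of the measurement outcomes
  turns the left-hand trace into \<open>1 / (|A|+1)\<close> times the sum over all \<open>\<theta>, k\<close> of
  \<open>tr(X S X S)\<close> with \<open>X = \<langle>\<theta>\<^sub>k|\<rho>|\<theta>\<^sub>k\<rangle>\<close>. A full set of mutually unbiased bases is a complex
  projective 2-design: the projectors satisfy \<open>\<Sum> P \<otimes> P = 1 + SWAP\<close>. The term \<open>1\<close> contributes
  \<open>tr(\<rho>\<^sub>B S \<rho>\<^sub>B S) = tr \<rho>\<close>, and the term \<open>SWAP\<close> contributes \<open>tr(\<rho> (1 \<otimes> S) \<rho> (1 \<otimes> S))\<close>,
  which is \<open>2 powr (- H\<^sub>2(A|B))\<close>.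
\<close>

section \<open>The spectral theorem for Hermitian matrices\<close>

lemma braket_add_right: "braket u (v + w) = braket u v + braket u w"
  by (simp add: braket_def algebra_simps sum.distrib)

lemma braket_add_left: "braket (u + v) w = braket u w + braket v w"
  by (simp add: braket_def algebra_simps sum.distrib)

lemma braket_smult_right: "braket u (c *s v) = c * braket u v"
  by (simp add: braket_def algebra_simps sum_distrib_left)

lemma braket_smult_left: "braket (c *s u) v = cnj c * braket u v"
  by (simp add: braket_def algebra_simps sum_distrib_left)

lemma braket_diff_right: "braket u (v - w) = braket u v - braket u w"
  by (simp add: braket_def algebra_simps sum_subtractf)

lemma braket_commute: "braket v u = cnj (braket u v)"
  by (simp add: braket_def mult.commute)

lemma braket_self: "braket u u = of_real ((norm u)\<^sup>2)"
  by (simp add: braket_def norm_vec_def L2_set_def real_sqrt_pow2 sum_nonneg mult.commute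
      complex_norm_square del: of_real_power)

lemma dagger_nth [simp]: "dagger M $ i $ j = cnj (M $ j $ i)"
  by (simp add: dagger_def map_matrix_def transpose_def)

lemma dagger_dagger [simp]: "dagger (dagger M) = M"
  by (simp add: vec_eq_iff)

lemma dagger_mult: "dagger (A ** B) = dagger B ** dagger A"
  by (simp add: vec_eq_iff matrix_matrix_mult_def mult.commute)

lemma braket_dagger: "braket (dagger M *v u) v = braket u (M *v v)"
proof -
  have "braket (dagger M *v u) v = (\<Sum>i\<in>UNIV. \<Sum>j\<in>UNIV. M $ j $ i * cnj (u $ j) * v $ i)"
    by (simp add: braket_def matrix_vector_mult_def sum_distrib_right)
  also have "\<dots> = (\<Sum>j\<in>UNIV. \<Sum>i\<in>UNIV. M $ j $ i * cnj (u $ j) * v $ i)"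
    by (rule sum.swap)
  also have "\<dots> = braket u (M *v v)"
    by (simp add: braket_def matrix_vector_mult_def sum_distrib_left mult_ac)
  finally show ?thesis .
qed

lemma continuous_on_braket [continuous_intros]:
  "continuous_on S f \<Longrightarrow> continuous_on S g \<Longrightarrow> continuous_on S (\<lambda>x. braket (f x) (g x))"
  unfolding braket_def by (intro continuous_intros)

lemma continuous_on_complex_matrix_vector_mult [continuous_intros]:
  fixes A :: "complex^'n^'m"
  shows "continuous_on S f \<Longrightarrow> continuous_on S (\<lambda>x. A *v f x)"
  unfolding matrix_vector_mult_def by (intro continuous_intros continuous_on_vec_lambda)

text \<open>The polynomial vanishes at 0 and so has its minimum there; its derivative at 0 is
  \<open>a\<close>. This supplies the first-order condition for the maximal Rayleigh
  quotient.\<close>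

lemma linear_term_zero:
  fixes a b :: real
  assumes "\<And>t. 0 \<le> t * a + t\<^sup>2 * b"
  shows "a = 0"
proof (rule ccontr)
  assume a: "a \<noteq> 0"
  \<comment> \<open>Adding 1 makes \<open>c\<close> positive even for \<open>b = 0\<close> and
    strictly larger than \<open>b\<close>, so the polynomial is negative at
    \<open>- a / c\<close>.\<close>
  define c where "c = \<bar>b\<bar> + 1"
  have c: "c > 0" "b < c" by (auto simp: c_def)
  have "0 \<le> (- a / c) * a + (- a / c)\<^sup>2 * b" by (rule assms)
  also have "\<dots> = (a\<^sup>2 / c\<^sup>2) * (b - c)"
    using c by (simp add: field_simps power2_eq_square)
  also have "\<dots> < 0" using a c by (intro mult_pos_neg) auto
  finally show False by simp
qed

text \<open>Maximise the Rayleigh quotient over the unit vectors of the subspace; the residual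
  \<open>\<mu> w - M w\<close> lies in the subspace, and moving along it would beat the maximum unless it vanishes.\<close>

lemma hermitian_eigenvector_in_subspace:
  fixes M :: "complex^'n^'n"
  assumes herm: "dagger M = M" and cl: "closed W"
    and add: "\<And>u v. u \<in> W \<Longrightarrow> v \<in> W \<Longrightarrow> u + v \<in> W"
    and smult: "\<And>c v. v \<in> W \<Longrightarrow> c *s v \<in> W"
    and inv: "\<And>v. v \<in> W \<Longrightarrow> M *v v \<in> W"
    and w0: "w0 \<in> W" "w0 \<noteq> 0"
  obtains w \<mu> where "w \<in> W" "braket w w = 1" "M *v w = of_real \<mu> *s w"
proof -
  define q where "q v = Re (braket v (M *v v))" for v
  have qs: "q (of_real c *s v) = c\<^sup>2 * q v" for c v
    by (simp add: q_def vector_scalar_commute braket_smult_left braket_smult_right power2_eq_square)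
  have nrm: "norm (complex_of_real c *s v) = \<bar>c\<bar> * norm v" for c and v :: "complex^'n"
  proof -
    have "complex_of_real ((norm (complex_of_real c *s v))\<^sup>2) = of_real ((\<bar>c\<bar> * norm v)\<^sup>2)"
      unfolding braket_self[symmetric] braket_smult_left braket_smult_right
      by (simp add: braket_self power2_eq_square mult_ac flip: of_real_mult)
    then have "(norm (complex_of_real c *s v))\<^sup>2 = (\<bar>c\<bar> * norm v)\<^sup>2"
      by (simp only: of_real_eq_iff)
    then show ?thesis by (rule power2_eq_imp_eq) auto
  qed
  let ?K = "W \<inter> sphere 0 1"
  have unit: "of_real (1 / norm v) *s v \<in> ?K" if "v \<in> W" "v \<noteq> 0" for v
    using that smult nrm[of "1 / norm v" v] by simp
  have "compact ?K" using cl by (simp add: closed_Int_compact)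
  moreover have "?K \<noteq> {}" using unit[OF w0] by blast
  moreover have "continuous_on ?K q" unfolding q_def by (intro continuous_intros)
  ultimately obtain w where w: "w \<in> ?K" and max: "\<And>y. y \<in> ?K \<Longrightarrow> q y \<le> q w"
    using continuous_attains_sup[of ?K q] by blast
  define \<mu> where "\<mu> = q w"
  have le: "q v \<le> \<mu> * (norm v)\<^sup>2" if "v \<in> W" for v
  proof (cases "v = 0")
    case True then show ?thesis by (simp add: q_def braket_def)
  next
    case False
    from max[OF unit[OF that False]] have "(1 / norm v)\<^sup>2 * q v \<le> \<mu>"
      unfolding qs \<mu>_def .
    then show ?thesis using False by (simp add: field_simps)
  qed
  \<comment> \<open>The residual is written as a sum of scalar multiples because these are the
    closure properties assumed of \<open>W\<close>.\<close>
  define r where "r = of_real \<mu> *s w + (-1) *s (M *v w)"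
  have rW: "r \<in> W" unfolding r_def using w by (intro add smult inv) auto
  have r': "r = of_real \<mu> *s w - M *v w" by (simp add: r_def vec_eq_iff)
  have ww: "braket w w = 1" using w by (simp add: braket_self)
  have Mw: "M *v w = of_real \<mu> *s w - r" by (simp add: r')
  have sym: "braket r (M *v w) = cnj (braket w (M *v r))"
    by (metis braket_commute braket_dagger herm)
  \<comment> \<open>Compare \<open>q\<close> with its bound at \<open>w + t r\<close>. The constant
    terms cancel, the terms with \<open>Re (braket w r)\<close> cancel, and the linear coefficient
    is twice the squared norm of \<open>r\<close>.\<close>
  have "0 \<le> t * (2 * (norm r)\<^sup>2) + t\<^sup>2 * (\<mu> * (norm r)\<^sup>2 - q r)" for t
  proof -
    let ?v = "w + of_real t *s r"
    have "?v \<in> W" using w rW by (intro add smult) auto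
    then have "q ?v \<le> \<mu> * (norm ?v)\<^sup>2" by (rule le)
    moreover have "(norm ?v)\<^sup>2 = 1 + 2 * t * Re (braket w r) + t\<^sup>2 * (norm r)\<^sup>2"
    proof -
      have "(norm ?v)\<^sup>2 = Re (braket ?v ?v)" by (simp add: braket_self)
      also have "\<dots> = 1 + 2 * t * Re (braket w r) + t\<^sup>2 * (norm r)\<^sup>2"
        using braket_commute[of r w]
        by (simp add: braket_add_left braket_add_right braket_smult_left braket_smult_right ww
            braket_self[of r] power2_eq_square algebra_simps)
      finally show ?thesis .
    qed
    moreover have "q ?v = \<mu> + 2 * t * Re (braket r (M *v w)) + t\<^sup>2 * q r"
      using sym
      by (simp add: q_def \<mu>_def matrix_vector_right_distrib vector_scalar_commute braket_add_left
          braket_add_right braket_smult_left braket_smult_right power2_eq_square algebra_simps)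
    moreover have "Re (braket r (M *v w)) = \<mu> * Re (braket w r) - (norm r)\<^sup>2"
      using braket_commute[of r w]
      by (simp add: Mw braket_diff_right braket_smult_right braket_self)
    ultimately show ?thesis by (simp add: algebra_simps)
  qed
  from linear_term_zero[OF this] have "r = 0" by simp
  then have "M *v w = of_real \<mu> *s w" by (simp add: Mw)
  with w ww show ?thesis by (intro that) auto
qed

text \<open>Induction on the index set: the orthogonal complement of the eigenvectors already found
  is invariant under \<open>M\<close> and, as long as an index is missing, nontrivial, so it
  contains a further eigenvector.\<close>

lemma hermitian_orthonormal_eigenvectors:
  fixes M :: "complex^'n^'n"
  assumes herm: "dagger M = M" and "finite (J :: 'n set)"
  shows "\<exists>v d. (\<forall>i\<in>J. \<forall>j\<in>J. braket (v i) (v j) = (if i = j then 1 else 0))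
           \<and> (\<forall>i\<in>J. M *v v i = of_real (d i :: real) *s v i)"
  using \<open>finite J\<close>
proof (induction J)
  case empty then show ?case by simp
next
  case (insert x J)
  obtain v and d :: "'n \<Rightarrow> real"
    where vd: "(\<forall>i\<in>J. \<forall>j\<in>J. braket (v i) (v j) = (if i = j then 1 else 0))
      \<and> (\<forall>i\<in>J. M *v v i = of_real (d i) *s v i)"
    using insert.IH by (elim exE) (rule that)
  then have v: "\<And>i j. i \<in> J \<Longrightarrow> j \<in> J \<Longrightarrow> braket (v i) (v j) = (if i = j then 1 else 0)"
    and d: "\<And>i. i \<in> J \<Longrightarrow> M *v v i = of_real (d i) *s v i" by blast+
  define W where "W = {w. \<forall>i\<in>J. braket (v i) w = 0}"
  \<comment> \<open>The kernel of \<open>A\<close> lies in \<open>W\<close>. Row \<open>x\<close> of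
    \<open>A\<close> is zero because \<open>x\<close> is not in \<open>J\<close>, so
    \<open>A\<close> is singular and the kernel is nontrivial.\<close>
  define A :: "complex^'n^'n" where "A = (\<chi> i j. if i \<in> J then cnj (v i $ j) else 0)"
  have "\<exists>w0. A *v w0 = 0 \<and> w0 \<noteq> 0"
  proof (rule ccontr)
    assume "\<not> ?thesis"
    then obtain B where "B ** A = mat 1" using matrix_left_invertible_ker[of A] by blast
    then have "A ** B = mat 1" using matrix_left_right_inverse by blast
    then have "(A ** B) $ x $ x = 1" by (simp add: mat_def)
    with insert.hyps show False by (simp add: A_def matrix_matrix_mult_def)
  qed
  then obtain w0 where w0: "A *v w0 = 0" "w0 \<noteq> 0" by blast
  have "braket (v i) w0 = (A *v w0) $ i" if "i \<in> J" for i
    using that by (simp add: A_def matrix_vector_mult_def braket_def)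
  then have w0W: "w0 \<in> W" using w0 by (simp add: W_def)
  have clW: "closed W" unfolding W_def Collect_ball_eq
    by (intro closed_INT ballI closed_Collect_eq continuous_intros)
  have invW: "M *v w \<in> W" if "w \<in> W" for w
    unfolding W_def mem_Collect_eq
  proof
    fix i assume i: "i \<in> J"
    have "braket (v i) (M *v w) = braket (M *v v i) w" by (metis braket_dagger herm)
    then show "braket (v i) (M *v w) = 0" using i that by (simp add: d W_def braket_smult_left)
  qed
  have addW: "u + w \<in> W" if "u \<in> W" "w \<in> W" for u w
    using that by (simp add: W_def braket_add_right)
  have smultW: "c *s w \<in> W" if "w \<in> W" for w c
    using that by (simp add: W_def braket_smult_right)
  obtain w \<mu> where w: "w \<in> W" "braket w w = 1" "M *v w = of_real \<mu> *s w"
    by (rule hermitian_eigenvector_in_subspace[OF herm clW addW smultW invW w0W w0(2)])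
  have wv: "braket (v i) w = 0" "braket w (v i) = 0" if "i \<in> J" for i
    using w(1) that braket_commute[of w "v i"] by (auto simp: W_def)
  show ?case
    using insert.hyps v d w wv
    by (intro exI[of _ "v(x := w)"] exI[of _ "d(x := \<mu>)"]) auto
qed

lemma onb_unitary:
  assumes "onb v"
  shows "unitary_mat (\<chi> i k. v k $ i)"
proof -
  have "dagger (\<chi> i k. v k $ i) ** (\<chi> i k. v k $ i) = mat 1"
    using assms by (simp add: vec_eq_iff matrix_matrix_mult_def onb_def braket_def mat_def)
  then show ?thesis by (simp add: unitary_mat_def matrix_left_right_inverse)
qed

text \<open>Orthonormality says that the matrix of columns has its adjoint as left inverse; for a
  square matrix it is also a right inverse, which is the completeness relation.\<close>

lemma onb_complete:
  assumes "onb v"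
  shows "(\<Sum>k\<in>UNIV. v k $ i * cnj (v k $ j)) = (if i = j then 1 else 0)"
proof -
  have "((\<chi> i k. v k $ i) ** dagger (\<chi> i k. v k $ i)) $ i $ j = mat 1 $ i $ j"
    using onb_unitary[OF assms] by (simp add: unitary_mat_def)
  then show ?thesis by (simp add: matrix_matrix_mult_def mat_def)
qed

lemma mult_real_diag: "(W ** real_diag g) $ i $ j = W $ i $ j * of_real (g j)"
  by (simp add: matrix_matrix_mult_def real_diag_def if_distrib if_distribR cong: if_cong)

lemma hermitian_diagonalization:
  fixes M :: "complex^'n^'n"
  assumes "dagger M = M"
  obtains U d where "unitary_mat U" "M = U ** real_diag d ** dagger U"
proof -
  obtain v and d :: "'n \<Rightarrow> real"
    where vd: "(\<forall>i\<in>UNIV. \<forall>j\<in>UNIV. braket (v i) (v j) = (if i = j then 1 else 0))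
      \<and> (\<forall>i\<in>UNIV. M *v v i = of_real (d i) *s v i)"
    using hermitian_orthonormal_eigenvectors[where J = UNIV, OF assms finite] by (elim exE) (rule that)
  then have v: "onb v" and d: "\<And>i. M *v v i = of_real (d i) *s v i"
    unfolding onb_def by simp_all
  let ?U = "\<chi> i k. v k $ i"
  have "(M *v v k) $ i = (of_real (d k) *s v k) $ i" for i k by (simp add: d)
  then have "M ** ?U = ?U ** real_diag d"
    by (simp add: vec_eq_iff mult_real_diag)
       (simp add: matrix_matrix_mult_def matrix_vector_mult_def mult.commute)
  moreover have "M = M ** (?U ** dagger ?U)"
    using onb_unitary[OF v] by (simp add: unitary_mat_def)
  ultimately have "M = ?U ** real_diag d ** dagger ?U"
    by (simp add: matrix_mul_assoc)
  with onb_unitary[OF v] show ?thesis by (rule that)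
qed

section \<open>Spectral calculus in a fixed eigenbasis\<close>

definition unitary_conj :: "complex^'n^'n \<Rightarrow> ('n \<Rightarrow> real) \<Rightarrow> complex^'n^'n" where
  "unitary_conj U d = U ** real_diag d ** dagger U"

lemma real_diag_mult: "real_diag f ** real_diag g = real_diag (\<lambda>i. f i * g i)"
  by (simp add: vec_eq_iff mult_real_diag) (simp add: real_diag_def)

text \<open>The inner factor \<open>dagger U ** U\<close> cancels. Operators with a common
  eigenbasis thus multiply like functions of the eigenvalue index, which reduces later operator
  identities to scalar ones.\<close>

lemma unitary_conj_mult:
  assumes "unitary_mat U"
  shows "unitary_conj U f ** unitary_conj U g = unitary_conj U (\<lambda>i. f i * g i)"
proof -
  have "unitary_conj U f ** unitary_conj U g
      = U ** real_diag f ** (dagger U ** U) ** real_diag g ** dagger U"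
    by (simp add: unitary_conj_def matrix_mul_assoc)
  also have "\<dots> = U ** (real_diag f ** real_diag g) ** dagger U"
    using assms by (simp add: unitary_mat_def matrix_mul_assoc)
  finally show ?thesis by (simp add: unitary_conj_def real_diag_mult)
qed

lemma trace_unitary_conj:
  assumes "unitary_mat U"
  shows "trace (unitary_conj U f) = (\<Sum>i\<in>UNIV. of_real (f i))"
proof -
  have "trace (unitary_conj U f) = trace (dagger U ** (U ** real_diag f))"
    unfolding unitary_conj_def by (rule trace_mul_sym)
  also have "\<dots> = trace (real_diag f)"
    using assms by (simp add: matrix_mul_assoc unitary_mat_def)
  finally show ?thesis by (simp add: trace_def real_diag_def)
qed

lemma dagger_real_diag [simp]: "dagger (real_diag f) = real_diag f"
  by (simp add: vec_eq_iff real_diag_def)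

lemma dagger_unitary_conj [simp]: "dagger (unitary_conj U f) = unitary_conj U f"
  by (simp add: unitary_conj_def dagger_mult matrix_mul_assoc)

lemma braket_axis: "braket (axis i 1) v = v $ i"
proof -
  have "braket (axis i 1) v = (\<Sum>j\<in>UNIV. if j = i then v $ j else 0)"
    unfolding braket_def by (intro sum.cong) (auto simp: axis_def)
  then show ?thesis by simp
qed

lemma real_diag_vector_mult: "(real_diag d *v v) $ i = of_real (d i) * v $ i"
proof -
  have "(real_diag d *v v) $ i = (\<Sum>j\<in>UNIV. (if i = j then of_real (d i) else 0) * v $ j)"
    by (simp add: matrix_vector_mult_def real_diag_def)
  also have "\<dots> = (\<Sum>j\<in>UNIV. if i = j then of_real (d i) * v $ j else 0)"
    by (intro sum.cong) auto
  finally show ?thesis by simp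
qed

text \<open>The eigenvalue \<open>d i\<close> is the value of the quadratic form of \<open>M\<close>
  at column \<open>i\<close> of \<open>U\<close>.\<close>

lemma psd_diagonalization:
  fixes M :: "complex^'n^'n"
  assumes "psd_mat M"
  obtains U d where "unitary_mat U" "M = unitary_conj U d" "\<And>i. 0 \<le> d i"
proof -
  from assms obtain U d where U: "unitary_mat U" and M: "M = U ** real_diag d ** dagger U"
    unfolding psd_mat_def by (elim conjE hermitian_diagonalization)
  have "0 \<le> d i" for i
  proof -
    have "0 \<le> Re (braket (U *v axis i 1) (M *v (U *v axis i 1)))"
      using assms by (simp add: psd_mat_def)
    also have "M *v (U *v axis i 1) = (U ** real_diag d ** (dagger U ** U)) *v axis i 1"
      by (simp add: M matrix_vector_mul_assoc matrix_mul_assoc)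
    also have "\<dots> = U *v (real_diag d *v axis i 1)"
      using U by (simp add: unitary_mat_def matrix_vector_mul_assoc)
    also have "braket (U *v axis i 1) \<dots>
        = braket ((dagger U ** U) *v axis i 1) (real_diag d *v axis i 1)"
      by (simp only: braket_dagger matrix_vector_mul_assoc[symmetric])
    also have "\<dots> = braket (axis i 1) (real_diag d *v axis i 1)"
      using U by (simp add: unitary_mat_def)
    also have "\<dots> = d i"
      by (simp add: braket_axis real_diag_vector_mult)
    finally show ?thesis by simp
  qed
  with U M show ?thesis by (intro that) (auto simp: unitary_conj_def)
qed

lemma psd_trace_pos:
  assumes "psd_mat M" "M \<noteq> 0"
  shows "0 < Re (trace M)"
proof -
  obtain U d where U: "unitary_mat U" and M: "M = unitary_conj U d" and d: "\<And>i. 0 \<le> d i"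
    by (rule psd_diagonalization[OF assms(1)]) (rule that)
  have "d \<noteq> (\<lambda>_. 0)"
  proof
    assume "d = (\<lambda>_. 0)"
    then have "real_diag d = 0" by (simp add: real_diag_def vec_eq_iff)
    then have "M = 0" unfolding M unitary_conj_def by (simp add: matrix_matrix_mult_def vec_eq_iff)
    then show False using assms(2) by blast
  qed
  then obtain i where "d i \<noteq> 0" by blast
  with d have "0 < d i" by (simp add: less_le)
  then have "0 < sum d UNIV" using d by (intro sum_pos2[of UNIV i]) auto
  then show ?thesis by (simp add: M trace_unitary_conj[OF U])
qed

section \<open>Mutually unbiased bases form a 2-design\<close>

lemma sum_UNIV_prod: "(\<Sum>p\<in>UNIV. f p) = (\<Sum>a\<in>UNIV. \<Sum>b\<in>UNIV. f (a, b))"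
  by (simp add: sum.cartesian_product flip: UNIV_Times_UNIV)

lemma braket_sum_left: "braket (\<Sum>x\<in>A. f x) v = (\<Sum>x\<in>A. braket (f x) v)"
  by (induction A rule: infinite_finite_induct) (simp_all add: braket_add_left, simp_all add: braket_def)

lemma braket_sum_right: "braket v (\<Sum>x\<in>A. f x) = (\<Sum>x\<in>A. braket v (f x))"
  by (induction A rule: infinite_finite_induct) (simp_all add: braket_add_right, simp_all add: braket_def)

lemma braket_diff_left: "braket (u - v) w = braket u w - braket v w"
  by (simp add: braket_def algebra_simps sum_subtractf)

lemma braket_self_eq_0: "braket u u = 0 \<longleftrightarrow> u = 0"
  by (simp add: braket_self)

lemma sum_product4:
  fixes f g h k :: "_ \<Rightarrow> 'a::comm_semiring_0"
  shows "(\<Sum>i\<in>A. \<Sum>j\<in>B. \<Sum>l\<in>C. \<Sum>m\<in>D. f i * g j * h l * k m) = sum f A * sum g B * sum h C * sum k D"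
  by (simp flip: sum_distrib_left sum_distrib_right)

lemma sum_if_const: "(\<Sum>x\<in>A. if b then f x else 0) = (if b then sum f A else 0)"
  by simp

text \<open>A finite family of unit vectors attaining the Welch bound for the frame potential is a
  complex projective 2-design: with \<open>\<Pi> = 1 + SWAP\<close>, the squared Hilbert--Schmidt
  norm of \<open>\<Sum>x |w\<^sub>x\<rangle>\<langle>w\<^sub>x|\<^sup>\<otimes>\<^sup>2 - \<Pi>\<close> vanishes.\<close>

lemma frame_potential_two_design:
  fixes w :: "'x::finite \<Rightarrow> complex^'a"
  assumes unit: "\<And>x. braket (w x) (w x) = 1"
    and pot: "\<And>x. (\<Sum>y\<in>UNIV. (cmod (braket (w x) (w y))) ^ 4) = 2"
    and card: "CARD('x) = CARD('a) * (CARD('a) + 1)"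
  shows "(\<Sum>x\<in>UNIV. w x $ i * cnj (w x $ j) * w x $ l * cnj (w x $ m))
       = (if i = j \<and> l = m then 1 else 0) + (if i = m \<and> l = j then 1 else 0)"
proof -
  \<comment> \<open>Flattening the twofold tensor power of the projector into a vector turns
    \<open>braket\<close> into the Hilbert-Schmidt inner product.\<close>
  define W :: "'x \<Rightarrow> complex^('a \<times> 'a \<times> 'a \<times> 'a)"
    where "W x = (\<chi> q. case q of (i, j, l, m) \<Rightarrow> w x $ i * cnj (w x $ j) * w x $ l * cnj (w x $ m))" for x
  \<comment> \<open>\<open>P1\<close> is the identity and \<open>P2\<close> the swap. The nested
    conditionals let the sums collapse one index at a time.\<close>
  define P1 P2 P :: "complex^('a \<times> 'a \<times> 'a \<times> 'a)"
    where "P1 = (\<chi> q. case q of (i, j, l, m) \<Rightarrow> if i = j then if l = m then 1 else 0 else 0)"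
      and "P2 = (\<chi> q. case q of (i, j, l, m) \<Rightarrow> if i = m then if l = j then 1 else 0 else 0)"
      and "P = P1 + P2"
  have WW: "braket (W x) (W y) = of_real ((cmod (braket (w x) (w y))) ^ 4)" for x y
  proof -
    have "braket (W x) (W y) = braket (w x) (w y) * cnj (braket (w x) (w y))
        * braket (w x) (w y) * cnj (braket (w x) (w y))"
      unfolding braket_def cnj_sum sum_product4[symmetric]
      by (simp add: W_def sum_UNIV_prod mult_ac)
    also have "\<dots> = of_real ((cmod (braket (w x) (w y)))\<^sup>2) * of_real ((cmod (braket (w x) (w y)))\<^sup>2)"
      by (simp only: complex_norm_square mult.assoc)
    also have "\<dots> = of_real ((cmod (braket (w x) (w y))) ^ 4)"
      by (simp flip: of_real_mult power_add)
    finally show ?thesis .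
  qed
  have WP: "braket (W x) P = 2" for x
  proof -
    have "braket (W x) P1 = braket (w x) (w x) * braket (w x) (w x)"
      unfolding braket_def
      by (simp add: W_def P1_def sum_UNIV_prod sum_if_const if_distrib[of "\<lambda>z. _ * z"]
          sum_distrib_left sum_distrib_right mult_ac cong: if_cong)
    moreover have "braket (W x) P2 = braket (w x) (w x) * braket (w x) (w x)"
      unfolding braket_def
      by (simp add: W_def P2_def sum_UNIV_prod if_distrib[of "\<lambda>z. _ * z"]
          sum_distrib_left sum_distrib_right mult_ac cong: if_cong)
    ultimately have "braket (W x) P = 1 + 1" by (simp add: P_def braket_add_right unit)
    then show ?thesis by simp
  qed
  have PP: "braket P P = of_nat (2 * CARD('a) * (CARD('a) + 1))"
  proof -
    note sums = P1_def P2_def sum_UNIV_prod sum_if_const if_distrib[of "\<lambda>z. _ * z"] if_distrib[of cnj]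
    have "braket P1 P1 = of_nat (CARD('a) * CARD('a))"
      unfolding braket_def by (simp add: sums cong: if_cong)
    moreover have "braket P2 P2 = of_nat (CARD('a) * CARD('a))"
      unfolding braket_def by (simp add: sums cong: if_cong)
    moreover have "braket P1 P2 = of_nat CARD('a)"
      unfolding braket_def by (simp add: sums cong: if_cong)
    moreover from this have "braket P2 P1 = of_nat CARD('a)"
      using braket_commute[of P2 P1] by simp
    ultimately show ?thesis
      by (simp add: P_def braket_add_left braket_add_right algebra_simps)
  qed
  define D where "D = (\<Sum>x\<in>UNIV. W x) - P"
  have PW: "braket P (W x) = 2" for x
    using WP[of x] braket_commute[of P "W x"] by simp
  have "(\<Sum>y\<in>UNIV. \<Sum>x\<in>UNIV. braket (W x) (W y)) = of_nat (2 * CARD('x))"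
    by (subst sum.swap) (simp only: WW of_real_sum[symmetric] pot, simp)
  \<comment> \<open>With N vectors, the double sum, either cross term and \<open>braket P P\<close>
    all equal 2N, so they cancel in the squared norm of the difference.\<close>
  then have "braket D D = 0"
    by (simp add: D_def braket_diff_left braket_diff_right braket_sum_left braket_sum_right WP PW PP
        card sum_subtractf algebra_simps)
  then have "(\<Sum>x\<in>UNIV. W x) = P" by (simp add: D_def braket_self_eq_0)
  then have "(\<Sum>x\<in>UNIV. W x) $ (i, j, l, m) = P $ (i, j, l, m)"
    by simp
  then have "(\<Sum>x\<in>UNIV. W x $ (i, j, l, m)) = P $ (i, j, l, m)"
    by (simp only: sum_component)
  moreover have "P $ (i, j, l, m)
      = (if i = j \<and> l = m then 1 else 0) + (if i = m \<and> l = j then 1 else 0)"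
  proof -
    have "(if a \<and> b then 1 else 0 :: complex) = (if a then if b then 1 else 0 else 0)" for a b
      by simp
    then show ?thesis
      by (simp only: P_def P1_def P2_def vector_add_component vec_lambda_beta prod.case)
  qed
  ultimately show ?thesis by (simp only: W_def vec_lambda_beta prod.case)
qed

text \<open>With d = |A|, the basis containing the vector contributes 1. Each of the d other bases
  contributes d terms of size 1/d^2, that is 1/d, for a total of 2.\<close>

lemma mubs_potential:
  fixes \<phi> :: "'t::finite \<Rightarrow> 'a::finite \<Rightarrow> complex^'a"
  assumes full: "CARD('t) = CARD('a) + 1" and mubs: "mubs \<phi>"
  shows "(\<Sum>y\<in>UNIV. (cmod (braket (\<phi> \<theta> k) (case y of (\<theta>', k') \<Rightarrow> \<phi> \<theta>' k'))) ^ 4) = 2"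
proof -
  have one: "(\<Sum>k'\<in>UNIV. (cmod (braket (\<phi> \<theta> k) (\<phi> \<theta>' k'))) ^ 4)
      = (if \<theta>' = \<theta> then 1 else 1 / real CARD('a))" for \<theta>'
  proof (cases "\<theta>' = \<theta>")
    case True
    have "(\<Sum>k'\<in>UNIV. (cmod (braket (\<phi> \<theta> k) (\<phi> \<theta> k'))) ^ 4) = (\<Sum>k'\<in>UNIV. if k = k' then 1 else 0)"
      using mubs by (intro sum.cong) (auto simp: mubs_def onb_def)
    then show ?thesis using True by simp
  next
    case False
    have "(cmod (braket (\<phi> \<theta> k) (\<phi> \<theta>' k'))) ^ 4 = 1 / (real CARD('a))\<^sup>2" for k'
    proof -
      have "cmod (braket (\<phi> \<theta> k) (\<phi> \<theta>' k')) = 1 / sqrt (real CARD('a))"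
        using mubs False by (auto simp: mubs_def)
      moreover have "sqrt (real CARD('a)) ^ 4 = (real CARD('a))\<^sup>2"
        using power_mult[of "sqrt (real CARD('a))" 2 2] by simp
      ultimately show ?thesis by (simp add: power_divide)
    qed
    then show ?thesis using False by (simp add: power2_eq_square)
  qed
  have "(\<Sum>\<theta>'\<in>UNIV. if \<theta>' = \<theta> then 1 else 1 / real CARD('a))
      = 1 + (\<Sum>\<theta>'\<in>UNIV - {\<theta>}. 1 / real CARD('a))"
    by (subst sum.remove[of _ \<theta>]) auto
  also have "\<dots> = 2" using full by simp
  finally show ?thesis by (simp add: sum_UNIV_prod one)
qed

text \<open>All vectors of all bases together form one family of d (d + 1) unit vectors, exactly the
  size at which potential 2 attains the Welch bound.\<close>

lemma mubs_two_design:
  fixes \<phi> :: "'t::finite \<Rightarrow> 'a::finite \<Rightarrow> complex^'a"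
  assumes full: "CARD('t) = CARD('a) + 1" and mubs: "mubs \<phi>"
  shows "(\<Sum>\<theta>\<in>UNIV. \<Sum>k\<in>UNIV. \<phi> \<theta> k $ i * cnj (\<phi> \<theta> k $ j) * \<phi> \<theta> k $ l * cnj (\<phi> \<theta> k $ m))
       = (if i = j \<and> l = m then 1 else 0) + (if i = m \<and> l = j then 1 else 0)"
proof -
  have "(\<Sum>x\<in>UNIV. case_prod \<phi> x $ i * cnj (case_prod \<phi> x $ j) * case_prod \<phi> x $ l * cnj (case_prod \<phi> x $ m))
       = (if i = j \<and> l = m then 1 else 0) + (if i = m \<and> l = j then 1 else 0)"
  proof (rule frame_potential_two_design)
    show "braket (case_prod \<phi> x) (case_prod \<phi> x) = 1" for x
      using mubs by (cases x) (simp add: mubs_def onb_def)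
    show "(\<Sum>y\<in>UNIV. (cmod (braket (case_prod \<phi> x) (case_prod \<phi> y))) ^ 4) = 2" for x
      using mubs_potential[OF assms] by (cases x) simp
    show "CARD('t \<times> 'a) = CARD('a) * (CARD('a) + 1)" by (simp add: full)
  qed
  then show ?thesis by (simp add: sum_UNIV_prod)
qed

section \<open>Kronecker products and partial traces\<close>

lemma kron_nth: "(A \<otimes>\<^sub>k B) $ (i, j) $ (k, l) = A $ i $ k * B $ j $ l"
  by (simp add: kron_def)

lemma kron_mult: "(A \<otimes>\<^sub>k B) ** (C \<otimes>\<^sub>k D) = (A ** C) \<otimes>\<^sub>k (B ** D)"
proof -
  have "((A \<otimes>\<^sub>k B) ** (C \<otimes>\<^sub>k D)) $ (i, j) $ (k, l) = ((A ** C) \<otimes>\<^sub>k (B ** D)) $ (i, j) $ (k, l)"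
    for i j k l
    by (simp add: matrix_matrix_mult_def kron_nth sum_UNIV_prod sum_product mult_ac)
  then show ?thesis by (simp add: vec_eq_iff)
qed

lemma dagger_mat_1 [simp]: "dagger (mat 1) = mat 1"
  by (simp add: vec_eq_iff mat_def)

lemma dagger_kron: "dagger (A \<otimes>\<^sub>k B) = dagger A \<otimes>\<^sub>k dagger B"
  by (simp add: vec_eq_iff kron_nth)

lemma kron_mat_1: "mat 1 \<otimes>\<^sub>k mat 1 = mat 1"
  by (simp add: vec_eq_iff kron_nth mat_def)

lemma trace_kron: "trace (A \<otimes>\<^sub>k B) = trace A * trace B"
  by (simp add: trace_def kron_nth sum_UNIV_prod sum_product)

lemma kron_scaleR_right: "A \<otimes>\<^sub>k (c *\<^sub>R B) = c *\<^sub>R (A \<otimes>\<^sub>k B)"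
  by (simp add: vec_eq_iff kron_nth)

lemma kron_sum_left: "(\<Sum>x\<in>X. A x) \<otimes>\<^sub>k B = (\<Sum>x\<in>X. A x \<otimes>\<^sub>k B)"
  by (simp add: vec_eq_iff kron_nth sum_distrib_right)

lemma kron_sum_right: "A \<otimes>\<^sub>k (\<Sum>x\<in>X. B x) = (\<Sum>x\<in>X. A \<otimes>\<^sub>k B x)"
  by (simp add: vec_eq_iff kron_nth sum_distrib_left)

lemma reassoc_kron: "reassoc ((A \<otimes>\<^sub>k B) \<otimes>\<^sub>k C) = A \<otimes>\<^sub>k B \<otimes>\<^sub>k C"
  by (simp add: reassoc_def vec_eq_iff kron_nth mult.assoc)

lemma real_diag_kron: "real_diag f \<otimes>\<^sub>k real_diag g = real_diag (\<lambda>p. f (fst p) * g (snd p))"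
  by (simp add: vec_eq_iff kron_nth real_diag_def)

lemma mat_1_real_diag: "mat 1 = real_diag (\<lambda>_. 1)"
  by (simp add: vec_eq_iff mat_def real_diag_def)

lemma unitary_mat_1: "unitary_mat (mat 1)"
  by (simp add: unitary_mat_def)

lemma mat_1_unitary_conj: "unitary_mat U \<Longrightarrow> mat 1 = unitary_conj U (\<lambda>_. 1)"
  by (simp add: unitary_conj_def unitary_mat_def flip: mat_1_real_diag)

lemma unitary_mat_kron: "unitary_mat U \<Longrightarrow> unitary_mat V \<Longrightarrow> unitary_mat (U \<otimes>\<^sub>k V)"
  by (simp add: unitary_mat_def dagger_kron kron_mult kron_mat_1)

lemma unitary_conj_kron:
  "unitary_conj U f \<otimes>\<^sub>k unitary_conj V g = unitary_conj (U \<otimes>\<^sub>k V) (\<lambda>p. f (fst p) * g (snd p))"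
  by (simp add: unitary_conj_def dagger_kron real_diag_kron flip: kron_mult)

lemma unitary_conj_scaleR: "c *\<^sub>R unitary_conj U f = unitary_conj U (\<lambda>i. c * f i)"
proof -
  have "unitary_conj U (\<lambda>i. c * f i) $ i $ j = (c *\<^sub>R unitary_conj U f) $ i $ j" for i j
    by (simp add: unitary_conj_def matrix_matrix_mult_def[of "_ ** _"] mult_real_diag)
       (simp add: scaleR_conv_of_real sum_distrib_left mult_ac)
  then show ?thesis by (simp add: vec_eq_iff)
qed

section \<open>Generalized inverse square roots\<close>

definition inv_sqrt :: "real \<Rightarrow> real" where
  "inv_sqrt x = (if x = 0 then 0 else x powr (- 1 / 2))"

text \<open>The value 0 at 0 keeps the function multiplicative there. This is what carries the
  generalized inverse square root through scalings and Kronecker products.\<close>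

lemma inv_sqrt_mult: "0 \<le> x \<Longrightarrow> 0 \<le> y \<Longrightarrow> inv_sqrt (x * y) = inv_sqrt x * inv_sqrt y"
  by (simp add: inv_sqrt_def powr_mult)

lemma inv_sqrt_1 [simp]: "inv_sqrt 1 = 1"
  by (simp add: inv_sqrt_def)

lemma inv_sqrt_nonneg: "0 \<le> inv_sqrt x"
  by (simp add: inv_sqrt_def)

lemma inv_sqrt_eq_0_iff: "0 \<le> x \<Longrightarrow> inv_sqrt x = 0 \<longleftrightarrow> x = 0"
  by (simp add: inv_sqrt_def)

lemma inv_sqrt_square: "0 \<le> x \<Longrightarrow> x \<noteq> 0 \<Longrightarrow> inv_sqrt x * inv_sqrt x = 1 / x"
  by (simp add: inv_sqrt_def powr_minus field_simps flip: powr_add)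

lemma gen_inv_sqrt_unitary_conj:
  assumes "unitary_mat U"
  shows "gen_inv_sqrt (unitary_conj U d) = unitary_conj U (\<lambda>i. inv_sqrt (d i))"
  using herm_fun_eq[OF assms refl, of inv_sqrt d]
  by (simp add: gen_inv_sqrt_def unitary_conj_def inv_sqrt_def[abs_def] comp_def)

lemma gen_inv_sqrt_scaleR:
  assumes "psd_mat M" "0 \<le> c"
  shows "gen_inv_sqrt (c *\<^sub>R M) = inv_sqrt c *\<^sub>R gen_inv_sqrt M"
proof -
  obtain U d where "unitary_mat U" "M = unitary_conj U d" "\<And>i. 0 \<le> d i"
    by (rule psd_diagonalization[OF assms(1)]) (rule that)
  then show ?thesis
    using assms(2) by (simp add: unitary_conj_scaleR gen_inv_sqrt_unitary_conj inv_sqrt_mult)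
qed

text \<open>The Kronecker product of the eigenbases diagonalizes
  \<open>M \<otimes>\<^sub>k N\<close>, with the products of the eigenvalues on the
  diagonal.\<close>

lemma gen_inv_sqrt_kron:
  assumes "psd_mat M" "psd_mat N"
  shows "gen_inv_sqrt (M \<otimes>\<^sub>k N) = gen_inv_sqrt M \<otimes>\<^sub>k gen_inv_sqrt N"
proof -
  obtain U d where U: "unitary_mat U" "M = unitary_conj U d" "\<And>i. 0 \<le> d i"
    by (rule psd_diagonalization[OF assms(1)]) (rule that)
  obtain V e where V: "unitary_mat V" "N = unitary_conj V e" "\<And>i. 0 \<le> e i"
    by (rule psd_diagonalization[OF assms(2)]) (rule that)
  show ?thesis using U V
    by (simp add: unitary_conj_kron gen_inv_sqrt_unitary_conj unitary_mat_kron inv_sqrt_mult)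
qed

lemma gen_inv_sqrt_mat_1: "gen_inv_sqrt (mat 1) = mat 1"
  using gen_inv_sqrt_unitary_conj[OF unitary_mat_1, of "\<lambda>_. 1"]
  by (simp flip: mat_1_unitary_conj[OF unitary_mat_1])

lemma psd_unitary_conj:
  assumes "\<And>i. 0 \<le> d i"
  shows "psd_mat (unitary_conj U d)"
proof -
  have "Re (braket v (unitary_conj U d *v v)) = (\<Sum>i\<in>UNIV. d i * (cmod ((dagger U *v v) $ i))\<^sup>2)" for v
  proof -
    have "braket v (unitary_conj U d *v v) = braket (dagger U *v v) (real_diag d *v (dagger U *v v))"
      by (simp add: unitary_conj_def braket_dagger matrix_vector_mul_assoc matrix_mul_assoc)
    also have "\<dots> = of_real (\<Sum>i\<in>UNIV. d i * (cmod ((dagger U *v v) $ i))\<^sup>2)"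
      unfolding braket_def real_diag_vector_mult of_real_sum of_real_mult complex_norm_square
      by (simp add: mult_ac)
    finally show ?thesis by simp
  qed
  then show ?thesis using assms by (simp add: psd_mat_def sum_nonneg)
qed

lemma psd_mat_1: "psd_mat (mat 1)"
  using psd_unitary_conj[of "\<lambda>_. 1" "mat 1"]
  by (simp flip: mat_1_unitary_conj[OF unitary_mat_1])

lemma psd_kron:
  assumes "psd_mat M" "psd_mat N"
  shows "psd_mat (M \<otimes>\<^sub>k N)"
proof -
  obtain U d where U: "unitary_mat U" "M = unitary_conj U d" "\<And>i. 0 \<le> d i"
    by (rule psd_diagonalization[OF assms(1)]) (rule that)
  obtain V e where V: "unitary_mat V" "N = unitary_conj V e" "\<And>i. 0 \<le> e i"
    by (rule psd_diagonalization[OF assms(2)]) (rule that)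
  show ?thesis unfolding U(2) V(2) unitary_conj_kron
    by (intro psd_unitary_conj) (simp add: U V)
qed

lemma psd_ptrace:
  fixes M :: "complex^('a::finite \<times> 'b::finite)^('a \<times> 'b)"
  assumes "psd_mat M"
  shows "psd_mat (ptrace_fst M)"
  unfolding psd_mat_def
proof (intro conjI allI)
  have "cnj (M $ p $ q) = M $ q $ p" for p q
    using assms dagger_nth[of M q p] by (simp add: psd_mat_def)
  then show "dagger (ptrace_fst M) = ptrace_fst M"
    by (simp add: vec_eq_iff ptrace_fst_def)
next
  fix v
  \<comment> \<open>\<open>u a\<close> is the basis vector \<open>a\<close> tensored with
    \<open>v\<close>; the quadratic form of the marginal at \<open>v\<close> is the sum of those of
    \<open>M\<close> at these vectors.\<close>
  define u :: "'a \<Rightarrow> complex^('a \<times> 'b)" where "u a = (\<chi> p. if a = fst p then v $ snd p else 0)" for a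
  have "braket (u a) (M *v u a) = (\<Sum>i\<in>UNIV. cnj (v $ i) * (\<Sum>j\<in>UNIV. M $ (a, i) $ (a, j) * v $ j))"
    for a
    by (simp add: braket_def u_def matrix_vector_mult_def sum_UNIV_prod sum_if_const
        if_distrib[of "\<lambda>z. _ * z"] if_distrib[of "\<lambda>z. z * _"] if_distrib[of cnj] cong: if_cong)
  then have "(\<Sum>a\<in>UNIV. braket (u a) (M *v u a))
      = (\<Sum>i\<in>UNIV. cnj (v $ i) * (\<Sum>a\<in>UNIV. \<Sum>j\<in>UNIV. M $ (a, i) $ (a, j) * v $ j))"
    by (simp add: sum_distrib_left) (rule sum.swap)
  also have "\<dots> = braket v (ptrace_fst M *v v)"
    unfolding braket_def ptrace_fst_def matrix_vector_mult_def
    by (subst sum.swap) (simp add: sum_distrib_right)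
  finally have "braket v (ptrace_fst M *v v) = (\<Sum>a\<in>UNIV. braket (u a) (M *v u a))" ..
  moreover have "0 \<le> Re (braket (u a) (M *v u a))" for a
    using assms by (simp add: psd_mat_def)
  ultimately show "0 \<le> Re (braket v (ptrace_fst M *v v))"
    by (simp add: sum_nonneg)
qed

lemma trace_ptrace: "trace (ptrace_fst M) = trace M"
  by (simp add: trace_def ptrace_fst_def sum_UNIV_prod) (rule sum.swap)

lemma ptrace_kron: "ptrace_fst (A \<otimes>\<^sub>k B) $ i $ j = trace A * B $ i $ j"
  by (simp add: ptrace_fst_def kron_nth trace_def sum_distrib_right)

lemma mat_1_kron_mult:
  "((mat 1 \<otimes>\<^sub>k Q) ** M) $ (a, i) $ q = (\<Sum>k\<in>UNIV. Q $ i $ k * M $ (a, k) $ q)"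
  by (simp add: matrix_matrix_mult_def kron_nth sum_UNIV_prod mat_def if_distribR sum_if_const
      if_distrib[of "\<lambda>z. z * _"] cong: if_cong)

lemma mult_mat_1_kron:
  "(M ** (mat 1 \<otimes>\<^sub>k Q)) $ p $ (a, i) = (\<Sum>k\<in>UNIV. M $ p $ (a, k) * Q $ k $ i)"
  by (simp add: matrix_matrix_mult_def kron_nth sum_UNIV_prod mat_def if_distribR sum_if_const
      if_distrib[of "\<lambda>z. z * _"] if_distrib[of "\<lambda>z. _ * z"] cong: if_cong)

text \<open>Only the first factor is summed over, and \<open>mat 1 \<otimes>\<^sub>k Q\<close> acts
  trivially on it, so both copies of \<open>Q\<close> come out of the sum.\<close>

lemma ptrace_sandwich:
  "ptrace_fst ((mat 1 \<otimes>\<^sub>k Q) ** M ** (mat 1 \<otimes>\<^sub>k Q)) = Q ** ptrace_fst M ** Q"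
proof -
  have "(\<Sum>a\<in>UNIV. \<Sum>l\<in>UNIV. (\<Sum>k\<in>UNIV. Q $ i $ k * M $ (a, k) $ (a, l)) * Q $ l $ j)
      = (\<Sum>l\<in>UNIV. (\<Sum>k\<in>UNIV. Q $ i $ k * (\<Sum>a\<in>UNIV. M $ (a, k) $ (a, l))) * Q $ l $ j)" for i j
  proof -
    have "(\<Sum>a\<in>UNIV. \<Sum>k\<in>UNIV. Q $ i $ k * M $ (a, k) $ (a, l))
        = (\<Sum>k\<in>UNIV. Q $ i $ k * (\<Sum>a\<in>UNIV. M $ (a, k) $ (a, l)))" for l
      unfolding sum_distrib_left by (rule sum.swap)
    then show ?thesis
      by (subst sum.swap) (simp flip: sum_distrib_right)
  qed
  then show ?thesis
    by (simp add: vec_eq_iff ptrace_fst_def mult_mat_1_kron mat_1_kron_mult)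
       (simp add: matrix_matrix_mult_def)
qed

lemma ptrace_sum: "ptrace_fst (\<Sum>x\<in>X. M x) = (\<Sum>x\<in>X. ptrace_fst (M x))"
  unfolding vec_eq_iff ptrace_fst_def sum_component vec_lambda_beta by (intro allI sum.swap)

lemma ptrace_scaleR: "ptrace_fst (c *\<^sub>R M) = c *\<^sub>R ptrace_fst M"
  by (simp add: vec_eq_iff ptrace_fst_def scaleR_sum_right)

section \<open>Measurement outcomes and their second moments\<close>

lemma proj_nth: "proj v $ i $ j = v $ i * cnj (v $ j)"
  by (simp add: proj_def)

lemma mat_1_nth: "mat 1 $ i $ j = (if i = j then 1 else 0)"
  by (simp add: mat_def)

lemma proj_complete:
  assumes "onb v"
  shows "(\<Sum>k\<in>UNIV. proj (v k)) = mat 1"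
  using onb_complete[OF assms] by (simp add: vec_eq_iff proj_def mat_def)

lemma trace_proj_mult: "trace (proj u ** proj v) = braket u v * braket v u"
  unfolding mult.commute[of "braket u v"] braket_def
  by (simp add: trace_def matrix_matrix_mult_def proj_def sum_product mult_ac)

lemma trace_proj: "trace (proj v) = braket v v"
  by (simp add: trace_def proj_def braket_def mult.commute)

text \<open>In bra-ket notation this is <v|M|v> taken on the first factor: for a state
  \<open>M\<close> and a unit vector \<open>v\<close>, the unnormalized state of the second system
  after outcome \<open>v\<close>.\<close>

definition compress :: "complex^'a \<Rightarrow> complex^('a::finite \<times> 'b::finite)^('a \<times> 'b) \<Rightarrow> complex^'b^'b" where
  "compress v M = (\<chi> i j. \<Sum>a\<in>UNIV. \<Sum>b\<in>UNIV. cnj (v $ a) * M $ (a, i) $ (b, j) * v $ b)"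

text \<open>A rank one projector on the first factor leaves no correlation with the second, so every
  summand of the measured state is a product operator.\<close>

lemma proj_sandwich:
  "(proj v \<otimes>\<^sub>k mat 1) ** M ** (proj v \<otimes>\<^sub>k mat 1) = proj v \<otimes>\<^sub>k compress v M"
proof -
  let ?P = "proj v \<otimes>\<^sub>k mat 1"
  have "(?P ** M ** ?P) $ (a, i) $ (b, j) = (proj v \<otimes>\<^sub>k compress v M) $ (a, i) $ (b, j)" for a i b j
  proof -
    have "(?P ** M) $ (a, i) $ q = (\<Sum>c\<in>UNIV. v $ a * cnj (v $ c) * M $ (c, i) $ q)" for q
      by (simp add: matrix_matrix_mult_def kron_nth sum_UNIV_prod proj_nth mat_1_nth
          if_distrib[of "\<lambda>z. z * _"] if_distrib[of "\<lambda>z. _ * z"] cong: if_cong)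
    then have "(?P ** M ** ?P) $ (a, i) $ (b, j)
        = (\<Sum>d\<in>UNIV. (\<Sum>c\<in>UNIV. v $ a * cnj (v $ c) * M $ (c, i) $ (d, j)) * (v $ d * cnj (v $ b)))"
      by (simp add: matrix_matrix_mult_def[of "?P ** M"] kron_nth sum_UNIV_prod proj_nth mat_1_nth
          if_distrib[of "\<lambda>z. z * _"] if_distrib[of "\<lambda>z. _ * z"] cong: if_cong)
    also have "\<dots> = (\<Sum>c\<in>UNIV. \<Sum>d\<in>UNIV. v $ a * cnj (v $ c) * M $ (c, i) $ (d, j) * (v $ d * cnj (v $ b)))"
      unfolding sum_distrib_right by (rule sum.swap)
    finally show ?thesis
      by (simp add: kron_nth proj_nth compress_def sum_distrib_left mult_ac)
  qed
  then show ?thesis by (simp add: vec_eq_iff)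
qed

text \<open>By the completeness relation the sum over outcomes contracts the two indices of the
  first factor: measuring one system leaves the marginal of the other unchanged.\<close>

lemma sum_compress:
  assumes "onb v"
  shows "(\<Sum>k\<in>UNIV. compress (v k) M) = ptrace_fst M"
proof -
  let ?F = "\<lambda>i j k p. M $ (fst p, i) $ (snd p, j) * (v k $ snd p * cnj (v k $ fst p))"
  have "(\<Sum>k\<in>UNIV. compress (v k) M $ i $ j) = ptrace_fst M $ i $ j" for i j
  proof -
    have "(\<Sum>k\<in>UNIV. compress (v k) M $ i $ j) = (\<Sum>k\<in>UNIV. \<Sum>p\<in>UNIV. ?F i j k p)"
      by (simp add: compress_def sum_UNIV_prod mult_ac)
    also have "\<dots> = (\<Sum>p\<in>UNIV. \<Sum>k\<in>UNIV. ?F i j k p)" by (rule sum.swap)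
    also have "\<dots> = ptrace_fst M $ i $ j"
      by (simp add: onb_complete[OF assms] sum_UNIV_prod ptrace_fst_def if_distrib[of "\<lambda>z. _ * z"]
          flip: sum_distrib_left cong: if_cong)
    finally show ?thesis .
  qed
  then show ?thesis by (simp add: vec_eq_iff)
qed

text \<open>Expand both compressions and insert the 2-design identity. Its identity part contracts
  each copy of \<open>M\<close> with itself, giving the two marginals; its swap part contracts
  across the copies.\<close>

lemma mubs_compress_moment:
  fixes M :: "complex^('a::finite \<times> 'b::finite)^('a \<times> 'b)" and \<phi> :: "'t::finite \<Rightarrow> 'a \<Rightarrow> complex^'a"
  assumes "CARD('t) = CARD('a) + 1" "mubs \<phi>"
  shows "(\<Sum>x\<in>UNIV. compress (case_prod \<phi> x) M $ p $ q * compress (case_prod \<phi> x) M $ r $ s)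
    = ptrace_fst M $ p $ q * ptrace_fst M $ r $ s
      + (\<Sum>a\<in>UNIV. \<Sum>b\<in>UNIV. M $ (a, p) $ (b, q) * M $ (b, r) $ (a, s))"
proof -
  let ?F = "\<lambda>x (a, b, c, d). M $ (a, p) $ (b, q) * M $ (c, r) $ (d, s)
      * (case_prod \<phi> x $ b * cnj (case_prod \<phi> x $ a) * case_prod \<phi> x $ d * cnj (case_prod \<phi> x $ c))"
  have "(\<Sum>x\<in>UNIV. compress (case_prod \<phi> x) M $ p $ q * compress (case_prod \<phi> x) M $ r $ s)
      = (\<Sum>x\<in>UNIV. \<Sum>z\<in>UNIV. ?F x z)"
  proof (intro sum.cong refl)
    fix x
    let ?v = "case_prod \<phi> x"
    have "compress ?v M $ p $ q * compress ?v M $ r $ s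
      = (\<Sum>a\<in>UNIV. \<Sum>b\<in>UNIV. \<Sum>c\<in>UNIV. \<Sum>d\<in>UNIV.
          cnj (?v $ a) * M $ (a, p) $ (b, q) * ?v $ b * (cnj (?v $ c) * M $ (c, r) $ (d, s) * ?v $ d))"
      by (simp add: compress_def flip: sum_distrib_left sum_distrib_right)
    then show "compress ?v M $ p $ q * compress ?v M $ r $ s = (\<Sum>z\<in>UNIV. ?F x z)"
      by (simp add: sum_UNIV_prod mult_ac)
  qed
  also have "\<dots> = (\<Sum>z\<in>UNIV. \<Sum>x\<in>UNIV. ?F x z)" by (rule sum.swap)
  also have "\<dots> = (\<Sum>a\<in>UNIV. \<Sum>b\<in>UNIV. \<Sum>c\<in>UNIV. \<Sum>d\<in>UNIV. M $ (a, p) $ (b, q) * M $ (c, r) $ (d, s)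
      * ((if b = a then if d = c then 1 else 0 else 0) + (if b = c then if d = a then 1 else 0 else 0)))"
  proof -
    have "(if a \<and> b then 1 else 0 :: complex) = (if a then if b then 1 else 0 else 0)" for a b
      by simp
    then show ?thesis
      by (simp add: sum_UNIV_prod mubs_two_design[OF assms] flip: sum_distrib_left cong: if_cong)
  qed
  also have "\<dots> = ptrace_fst M $ p $ q * ptrace_fst M $ r $ s
      + (\<Sum>a\<in>UNIV. \<Sum>b\<in>UNIV. M $ (a, p) $ (b, q) * M $ (b, r) $ (a, s))"
    by (simp add: distrib_left sum.distrib sum_if_const if_distrib[of "\<lambda>z. _ * z"] ptrace_fst_def
        sum_product cong: if_cong)
  finally show ?thesis .
qed

text \<open>The entries of \<open>S\<close> are gathered in one weight, so that summing over
  outcomes only affects a product of one entry of \<open>X\<close> and one of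
  \<open>Y\<close>.\<close>

lemma trace_mult4:
  fixes X Y S :: "complex^'n^'n"
  shows "trace (X ** S ** Y ** S) = (\<Sum>(p, r, q, s)\<in>UNIV. X $ p $ q * Y $ r $ s * (S $ q $ r * S $ s $ p))"
proof -
  have "trace (X ** S ** Y ** S) = trace ((X ** S) ** (Y ** S))" by (simp add: matrix_mul_assoc)
  also have "\<dots> = (\<Sum>p\<in>UNIV. \<Sum>r\<in>UNIV. (\<Sum>q\<in>UNIV. X $ p $ q * S $ q $ r) * (\<Sum>s\<in>UNIV. Y $ r $ s * S $ s $ p))"
    unfolding trace_def by (simp add: matrix_matrix_mult_def)
  also have "\<dots> = (\<Sum>(p, r, q, s)\<in>UNIV. X $ p $ q * Y $ r $ s * (S $ q $ r * S $ s $ p))"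
    by (simp add: sum_UNIV_prod sum_product) (intro sum.cong refl, simp add: mult_ac)
  finally show ?thesis .
qed

text \<open>The weight in \<open>S\<close> is the same as in \<open>trace_mult4\<close>, and its
  coefficient is the crossed contraction produced by the swap.\<close>

lemma trace_mult4_mat_1_kron:
  fixes M :: "complex^('a::finite \<times> 'b::finite)^('a \<times> 'b)"
  shows "trace (M ** (mat 1 \<otimes>\<^sub>k S) ** M ** (mat 1 \<otimes>\<^sub>k S))
    = (\<Sum>(p, r, q, s)\<in>UNIV. (\<Sum>a\<in>UNIV. \<Sum>b\<in>UNIV. M $ (a, p) $ (b, q) * M $ (b, r) $ (a, s))
         * (S $ q $ r * S $ s $ p))"
proof -
  let ?S = "mat 1 \<otimes>\<^sub>k S :: complex^('a \<times> 'b)^('a \<times> 'b)"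
  let ?F = "\<lambda>(a, b) (p, r, q, s). M $ (a, p) $ (b, q) * M $ (b, r) $ (a, s) * (S $ q $ r * S $ s $ p)"
  have "trace (M ** ?S ** M ** ?S) = trace ((M ** ?S) ** (M ** ?S))" by (simp add: matrix_mul_assoc)
  also have "\<dots> = (\<Sum>a\<in>UNIV. \<Sum>p\<in>UNIV. \<Sum>b\<in>UNIV. \<Sum>r\<in>UNIV.
      (M ** ?S) $ (a, p) $ (b, r) * (M ** ?S) $ (b, r) $ (a, p))"
    by (simp add: trace_def matrix_matrix_mult_def[of "M ** ?S"] sum_UNIV_prod)
  also have "\<dots> = (\<Sum>a\<in>UNIV. \<Sum>b\<in>UNIV. \<Sum>p\<in>UNIV. \<Sum>r\<in>UNIV.
      (M ** ?S) $ (a, p) $ (b, r) * (M ** ?S) $ (b, r) $ (a, p))"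
    by (intro sum.cong refl sum.swap)
  also have "\<dots> = (\<Sum>w\<in>UNIV. \<Sum>z\<in>UNIV. ?F w z)"
    by (simp add: mult_mat_1_kron sum_UNIV_prod sum_product) (intro sum.cong refl, simp add: mult_ac)
  also have "\<dots> = (\<Sum>z\<in>UNIV. \<Sum>w\<in>UNIV. ?F w z)" by (rule sum.swap)
  finally show ?thesis by (simp add: sum_UNIV_prod sum_distrib_right)
qed

lemma mubs_trace_sum:
  fixes M :: "complex^('a::finite \<times> 'b::finite)^('a \<times> 'b)" and \<phi> :: "'t::finite \<Rightarrow> 'a \<Rightarrow> complex^'a"
  assumes "CARD('t) = CARD('a) + 1" "mubs \<phi>"
  shows "(\<Sum>x\<in>UNIV. trace (compress (case_prod \<phi> x) M ** S ** compress (case_prod \<phi> x) M ** S))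
    = trace (ptrace_fst M ** S ** ptrace_fst M ** S)
      + trace (M ** (mat 1 \<otimes>\<^sub>k S) ** M ** (mat 1 \<otimes>\<^sub>k S))"
proof -
  let ?c = "\<lambda>x. compress (case_prod \<phi> x) M" and ?P = "ptrace_fst M"
  let ?K = "\<lambda>p r q s. S $ q $ r * S $ s $ p"
  let ?R = "\<lambda>p r q s. \<Sum>a\<in>UNIV. \<Sum>b\<in>UNIV. M $ (a, p) $ (b, q) * M $ (b, r) $ (a, s)"
  have "(\<Sum>x\<in>UNIV. trace (?c x ** S ** ?c x ** S))
      = (\<Sum>z\<in>UNIV. \<Sum>x\<in>UNIV. case z of (p, r, q, s) \<Rightarrow> ?c x $ p $ q * ?c x $ r $ s * ?K p r q s)"
    unfolding trace_mult4 by (rule sum.swap)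
  also have "\<dots> = (\<Sum>(p, r, q, s)\<in>UNIV. (\<Sum>x\<in>UNIV. ?c x $ p $ q * ?c x $ r $ s) * ?K p r q s)"
    unfolding sum_distrib_right by (intro sum.cong refl) (simp add: split_def)
  also have "\<dots> = (\<Sum>(p, r, q, s)\<in>UNIV. (?P $ p $ q * ?P $ r $ s + ?R p r q s) * ?K p r q s)"
    unfolding mubs_compress_moment[OF assms] ..
  also have "\<dots> = (\<Sum>(p, r, q, s)\<in>UNIV. ?P $ p $ q * ?P $ r $ s * ?K p r q s)
      + (\<Sum>(p, r, q, s)\<in>UNIV. ?R p r q s * ?K p r q s)"
    unfolding distrib_right split_def by (rule sum.distrib)
  also have "\<dots> = trace (?P ** S ** ?P ** S)
      + trace (M ** (mat 1 \<otimes>\<^sub>k S) ** M ** (mat 1 \<otimes>\<^sub>k S))"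
    unfolding trace_mult4_mat_1_kron trace_mult4[of "?P"] ..
  finally show ?thesis .
qed

lemma sum_matrix_mult: "(\<Sum>x\<in>X. A x) ** B = (\<Sum>x\<in>X. A x ** B)"
  for A :: "_ \<Rightarrow> complex^'n^'m" and B :: "complex^'k^'n"
proof -
  have "(\<Sum>l\<in>UNIV. (\<Sum>x\<in>X. A x $ i $ l) * B $ l $ j) = (\<Sum>x\<in>X. \<Sum>l\<in>UNIV. A x $ i $ l * B $ l $ j)" for i j
    unfolding sum_distrib_right by (rule sum.swap)
  then show ?thesis by (simp add: vec_eq_iff matrix_matrix_mult_def)
qed

lemma matrix_mult_sum_right: "B ** (\<Sum>x\<in>X. A x) = (\<Sum>x\<in>X. B ** A x)"
  for A :: "_ \<Rightarrow> complex^'m^'n" and B :: "complex^'n^'k"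
proof -
  have "(\<Sum>l\<in>UNIV. B $ i $ l * (\<Sum>x\<in>X. A x $ l $ j)) = (\<Sum>x\<in>X. \<Sum>l\<in>UNIV. B $ i $ l * A x $ l $ j)" for i j
    unfolding sum_distrib_left by (rule sum.swap)
  then show ?thesis by (simp add: vec_eq_iff matrix_matrix_mult_def)
qed

lemma trace_sum: "trace (\<Sum>x\<in>X. A x) = (\<Sum>x\<in>X. trace (A x))" for A :: "_ \<Rightarrow> complex^'n^'n"
  unfolding trace_def sum_component by (rule sum.swap)

lemma scaleR_matrix_mult: "(c *\<^sub>R A) ** B = c *\<^sub>R (A ** B)" for A :: "complex^'n^'m" and B :: "complex^'k^'n"
  by (simp add: vec_eq_iff matrix_matrix_mult_def scaleR_sum_right)

lemma matrix_mult_scaleR: "A ** (c *\<^sub>R B) = c *\<^sub>R (A ** B)" for A :: "complex^'n^'m" and B :: "complex^'k^'n"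
  by (simp add: vec_eq_iff matrix_matrix_mult_def scaleR_sum_right)

lemma trace_scaleR: "trace (c *\<^sub>R A) = c *\<^sub>R trace A" for A :: "complex^'n^'n"
  by (simp add: trace_def scaleR_sum_right)

section \<open>The measured state and its collision entropy\<close>

lemma post_meas_state_eq:
  fixes \<rho> :: "complex^('a::finite \<times> 'b::finite)^('a \<times> 'b)" and \<phi> :: "'t::finite \<Rightarrow> 'a \<Rightarrow> complex^'a"
  shows "post_meas_state \<phi> e \<rho> = (1 / real (CARD('a) + 1)) *\<^sub>R
    (\<Sum>x\<in>UNIV. proj (case_prod \<phi> x) \<otimes>\<^sub>k compress (case_prod \<phi> x) \<rho> \<otimes>\<^sub>k proj (e (fst x)))"
  by (simp add: post_meas_state_def proj_sandwich reassoc_kron sum_UNIV_prod)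

text \<open>For every basis the conditional operators add up to the same marginal, which therefore
  factors out, and the register projectors add up to the identity.\<close>

lemma ptrace_post_meas_state:
  fixes \<rho> :: "complex^('a::finite \<times> 'b::finite)^('a \<times> 'b)" and \<phi> :: "'t::finite \<Rightarrow> 'a \<Rightarrow> complex^'a"
  assumes onb: "\<And>\<theta>. onb (\<phi> \<theta>)" and e: "onb e"
  shows "ptrace_fst (post_meas_state \<phi> e \<rho>) = (1 / real (CARD('a) + 1)) *\<^sub>R (ptrace_fst \<rho> \<otimes>\<^sub>k mat 1)"
proof -
  have one: "ptrace_fst (proj (\<phi> \<theta> k) \<otimes>\<^sub>k X) = X" for \<theta> k and X :: "complex^('b \<times> 't)^('b \<times> 't)"
    using onb by (simp add: vec_eq_iff ptrace_kron trace_proj onb_def)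
  have "ptrace_fst (\<Sum>x\<in>UNIV. proj (case_prod \<phi> x) \<otimes>\<^sub>k compress (case_prod \<phi> x) \<rho> \<otimes>\<^sub>k proj (e (fst x)))
      = (\<Sum>\<theta>\<in>UNIV. \<Sum>k\<in>UNIV. compress (\<phi> \<theta> k) \<rho> \<otimes>\<^sub>k proj (e \<theta>))"
    by (simp add: ptrace_sum sum_UNIV_prod one)
  also have "\<dots> = ptrace_fst \<rho> \<otimes>\<^sub>k mat 1"
    by (simp add: sum_compress[OF onb] proj_complete[OF e] flip: kron_sum_left kron_sum_right)
  finally show ?thesis by (simp add: post_meas_state_eq ptrace_scaleR)
qed

text \<open>Cross terms between different outcomes vanish: the register separates different bases,
  and orthonormality separates outcomes within one basis. The diagonal terms are summed by
  \<open>mubs_trace_sum\<close>.\<close>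

lemma trace_post_meas_state:
  fixes \<rho> :: "complex^('a::finite \<times> 'b::finite)^('a \<times> 'b)" and \<phi> :: "'t::finite \<Rightarrow> 'a \<Rightarrow> complex^'a"
    and S :: "complex^'b^'b"
  assumes full: "CARD('t) = CARD('a) + 1" and mubs: "mubs \<phi>" and e: "onb e"
  defines "T \<equiv> mat 1 \<otimes>\<^sub>k S \<otimes>\<^sub>k mat 1 :: complex^('a \<times> 'b \<times> 't)^('a \<times> 'b \<times> 't)"
  shows "trace (post_meas_state \<phi> e \<rho> ** T ** post_meas_state \<phi> e \<rho> ** T)
    = (1 / real (CARD('a) + 1))\<^sup>2 *\<^sub>R (trace (ptrace_fst \<rho> ** S ** ptrace_fst \<rho> ** S)
        + trace (\<rho> ** (mat 1 \<otimes>\<^sub>k S) ** \<rho> ** (mat 1 \<otimes>\<^sub>k S)))"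
proof -
  let ?c = "\<lambda>x. compress (case_prod \<phi> x) \<rho>"
  let ?B = "\<lambda>x. proj (case_prod \<phi> x) \<otimes>\<^sub>k ?c x \<otimes>\<^sub>k proj (e (fst x))"
  have "trace (?B x ** T ** ?B y ** T) = (if x = y then trace (?c x ** S ** ?c x ** S) else 0)" for x y
  proof -
    have "trace (?B x ** T ** ?B y ** T)
        = trace (proj (case_prod \<phi> x) ** proj (case_prod \<phi> y))
          * (trace (?c x ** S ** ?c y ** S) * trace (proj (e (fst x)) ** proj (e (fst y))))"
      by (simp only: T_def kron_mult trace_kron matrix_mul_rid)
    moreover have "trace (proj (e (fst x)) ** proj (e (fst y))) = (if fst x = fst y then 1 else 0)"
      using e by (simp add: trace_proj_mult onb_def)
    \<comment> \<open>The restriction to one basis is essential, since vectors of different unbiased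
      bases have nonzero overlap.\<close>
    moreover have "fst x = fst y \<Longrightarrow>
        trace (proj (case_prod \<phi> x) ** proj (case_prod \<phi> y)) = (if snd x = snd y then 1 else 0)"
      using mubs by (cases x, cases y) (simp add: trace_proj_mult mubs_def onb_def)
    moreover have "x \<noteq> y \<Longrightarrow> fst x = fst y \<Longrightarrow> snd x \<noteq> snd y"
      by (simp add: prod_eq_iff)
    ultimately show ?thesis by (cases "x = y"; cases "fst x = fst y") simp_all
  qed
  then have "trace ((\<Sum>x\<in>UNIV. ?B x) ** T ** (\<Sum>y\<in>UNIV. ?B y) ** T)
      = (\<Sum>x\<in>UNIV. trace (?c x ** S ** ?c x ** S))"
    by (simp add: sum_matrix_mult matrix_mult_sum_right trace_sum)
  then show ?thesis
    by (simp add: post_meas_state_eq scaleR_matrix_mult matrix_mult_scaleR trace_scaleR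
        mubs_trace_sum[OF full mubs] power2_eq_square)
qed

text \<open>The trace is the squared Hilbert-Schmidt norm, computed as the sum of the squared norms
  of the columns.\<close>

lemma trace_dagger_mult_pos:
  assumes "G \<noteq> 0"
  shows "0 < Re (trace (dagger G ** G))"
proof -
  have "trace (dagger G ** G) = (\<Sum>i\<in>UNIV. braket (column i G) (column i G))"
    by (simp add: trace_def matrix_matrix_mult_def column_def braket_def)
  then have "trace (dagger G ** G) = of_real (\<Sum>i\<in>UNIV. (norm (column i G))\<^sup>2)"
    by (simp only: braket_self of_real_sum)
  moreover obtain i j where "G $ i $ j \<noteq> 0" using assms by (auto simp: vec_eq_iff)
  then have "column j G \<noteq> 0" by (auto simp: column_def vec_eq_iff)
  then have "0 < (\<Sum>i\<in>UNIV. (norm (column i G))\<^sup>2)"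
    by (intro sum_pos2[of UNIV j]) auto
  ultimately show ?thesis by simp
qed

text \<open>The trace is the squared Hilbert--Schmidt norm of \<open>G = Q \<rho> Q\<close> with \<open>Q = 1 \<otimes> \<rho>\<^sub>B\<^sup>-\<^sup>1\<^sup>/\<^sup>4\<close>, and
  \<open>G\<close> is nonzero because its marginal is \<open>\<rho>\<^sub>B\<^sup>1\<^sup>/\<^sup>2\<close>.\<close>

lemma conditional_purity_pos:
  fixes \<rho> :: "complex^('a::finite \<times> 'b::finite)^('a \<times> 'b)"
  assumes psd: "psd_mat \<rho>" and nonzero: "\<rho> \<noteq> 0"
  defines "S \<equiv> mat 1 \<otimes>\<^sub>k gen_inv_sqrt (ptrace_fst \<rho>)"
  shows "0 < Re (trace (\<rho> ** S ** \<rho> ** S))"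
proof -
  obtain U d where U: "unitary_mat U" and d: "ptrace_fst \<rho> = unitary_conj U d" "\<And>i. 0 \<le> d i"
    by (rule psd_diagonalization[OF psd_ptrace[OF psd]]) (rule that)
  define Q where "Q = unitary_conj U (\<lambda>i. sqrt (inv_sqrt (d i)))"
  let ?Q = "mat 1 \<otimes>\<^sub>k Q :: complex^('a \<times> 'b)^('a \<times> 'b)"
  define G where "G = ?Q ** \<rho> ** ?Q"
  have S: "S = ?Q ** ?Q"
    by (simp add: S_def Q_def d gen_inv_sqrt_unitary_conj[OF U] kron_mult unitary_conj_mult[OF U]
        inv_sqrt_nonneg)
  have "trace (\<rho> ** S ** \<rho> ** S) = trace ((\<rho> ** ?Q ** ?Q ** \<rho> ** ?Q) ** ?Q)"
    by (simp add: S matrix_mul_assoc)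
  also have "\<dots> = trace (?Q ** (\<rho> ** ?Q ** ?Q ** \<rho> ** ?Q))" by (rule trace_mul_sym)
  also have "\<dots> = trace (G ** G)" by (simp add: G_def matrix_mul_assoc)
  also have "G ** G = dagger G ** G"
    using psd by (simp add: G_def Q_def dagger_mult dagger_kron psd_mat_def matrix_mul_assoc)
  finally have tr: "trace (\<rho> ** S ** \<rho> ** S) = trace (dagger G ** G)" .
  have "G \<noteq> 0"
  proof
    assume "G = 0"
    then have "ptrace_fst G = 0" by (simp add: ptrace_fst_def vec_eq_iff)
    then have "unitary_conj U (\<lambda>i. sqrt (inv_sqrt (d i)) * d i * sqrt (inv_sqrt (d i))) = 0"
      by (simp add: G_def ptrace_sandwich d Q_def unitary_conj_mult[OF U])
    \<comment> \<open>Taking the trace turns the vanishing operator into a vanishing sum of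
      nonnegative reals, whose terms must all be zero.\<close>
    then have "complex_of_real (\<Sum>i\<in>UNIV. sqrt (inv_sqrt (d i)) * d i * sqrt (inv_sqrt (d i))) = 0"
      unfolding of_real_sum trace_unitary_conj[OF U, symmetric] by (simp add: trace_def)
    then have "sqrt (inv_sqrt (d i)) * d i * sqrt (inv_sqrt (d i)) = 0" for i
      using d(2) by (subst (asm) of_real_eq_0_iff, subst (asm) sum_nonneg_eq_0_iff)
        (auto simp: inv_sqrt_nonneg)
    then have "d i = 0" for i
      using d(2) inv_sqrt_eq_0_iff by fastforce
    then have "trace (ptrace_fst \<rho>) = 0" by (simp add: d trace_unitary_conj[OF U])
    with psd_trace_pos[OF psd nonzero] show False by (simp add: trace_ptrace)
  qed
  then show ?thesis unfolding tr by (rule trace_dagger_mult_pos)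
qed

text \<open>A nonzero eigenvalue x contributes x^2 / x = x, and the eigenvalue 0 contributes 0 by
  the convention for the inverse. This produces the trace term in the final formula.\<close>

lemma trace_marginal:
  assumes "psd_mat M"
  shows "trace (M ** gen_inv_sqrt M ** M ** gen_inv_sqrt M) = trace M"
proof -
  obtain U d where U: "unitary_mat U" and d: "M = unitary_conj U d" "\<And>i. 0 \<le> d i"
    by (rule psd_diagonalization[OF assms]) (rule that)
  have "d i * inv_sqrt (d i) * d i * inv_sqrt (d i) = d i" for i
    using inv_sqrt_square[OF d(2), of i] by (cases "d i = 0") (simp_all add: mult_ac)
  then have "(\<lambda>i. d i * inv_sqrt (d i) * d i * inv_sqrt (d i)) = d" ..
  then show ?thesis
    by (simp add: d gen_inv_sqrt_unitary_conj[OF U] unitary_conj_mult[OF U])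
qed

lemma inv_sqrt_inverse: "0 < x \<Longrightarrow> (inv_sqrt (1 / x))\<^sup>2 = x"
  by (simp add: inv_sqrt_square power2_eq_square)

text \<open>The identity part of the 2-design yields the trace of \<open>\<rho>\<close>, so the
  summand is 1 exactly for normalized states. At \<open>\<rho> = 0\<close> the purity traces vanish
  and their logarithms are mere default values.\<close>

theorem theorem3p1:
  fixes \<rho> :: "complex^('a::finite \<times> 'b::finite)^('a \<times> 'b)"
    and \<phi> :: "'t::finite \<Rightarrow> 'a \<Rightarrow> complex^'a"
    and e :: "'t \<Rightarrow> complex^'t"
  assumes psd: "psd_mat \<rho>"
    and subnormalized: "Re (trace \<rho>) \<le> 1"
    and nonzero: "\<rho> \<noteq> 0"
    and full: "CARD('t) = CARD('a) + 1"
    and mubs: "mubs \<phi>"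
    and register: "onb e"
  shows "cond_entropy2 (post_meas_state \<phi> e \<rho>) =
           log 2 (real (CARD('a) + 1)) - log 2 (2 powr (- cond_entropy2 \<rho>) + Re (trace \<rho>))
       \<and> (trace \<rho> = 1 \<longrightarrow>
           cond_entropy2 (post_meas_state \<phi> e \<rho>) =
             log 2 (real (CARD('a) + 1)) - log 2 (2 powr (- cond_entropy2 \<rho>) + 1))"
proof -
  define n where "n = real (CARD('a) + 1)"
  have n: "0 < n" by (simp add: n_def)
  note psdB = psd_ptrace[OF psd]
  define S where "S = gen_inv_sqrt (ptrace_fst \<rho>)"
  define t where "t = Re (trace (\<rho> ** (mat 1 \<otimes>\<^sub>k S) ** \<rho> ** (mat 1 \<otimes>\<^sub>k S)))"
  have t: "0 < t" using conditional_purity_pos[OF psd nonzero] by (simp add: t_def S_def)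
  have tr: "0 < Re (trace \<rho>)" using psd nonzero by (rule psd_trace_pos)
  have "gen_inv_sqrt (mat 1 \<otimes>\<^sub>k ptrace_fst \<rho> :: complex^('a \<times> 'b)^('a \<times> 'b)) = mat 1 \<otimes>\<^sub>k S"
    by (simp add: gen_inv_sqrt_kron psd_mat_1 psdB gen_inv_sqrt_mat_1 S_def)
  then have H: "cond_entropy2 \<rho> = - log 2 t"
    by (simp add: cond_entropy2_def t_def Let_def)
  let ?T = "mat 1 \<otimes>\<^sub>k S \<otimes>\<^sub>k mat 1 :: complex^('a \<times> 'b \<times> 't)^('a \<times> 'b \<times> 't)"
  let ?\<sigma> = "post_meas_state \<phi> e \<rho>"
  \<comment> \<open>Products nest to the right, so tracing out the first factor removes K and keeps
    B together with the register.\<close>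
  have "ptrace_fst ?\<sigma> = (1 / n) *\<^sub>R (ptrace_fst \<rho> \<otimes>\<^sub>k mat 1)"
    unfolding n_def using mubs register by (intro ptrace_post_meas_state) (simp_all add: mubs_def)
  then have "gen_inv_sqrt (mat 1 \<otimes>\<^sub>k ptrace_fst ?\<sigma>) = inv_sqrt (1 / n) *\<^sub>R ?T"
    using n by (simp add: kron_scaleR_right gen_inv_sqrt_scaleR gen_inv_sqrt_kron
        psd_kron psd_mat_1 psdB gen_inv_sqrt_mat_1 S_def)
  then have "cond_entropy2 ?\<sigma> = - log 2 (Re ((inv_sqrt (1 / n))\<^sup>2 *\<^sub>R trace (?\<sigma> ** ?T ** ?\<sigma> ** ?T)))"
    by (simp add: cond_entropy2_def Let_def scaleR_matrix_mult matrix_mult_scaleR trace_scaleR power2_eq_square)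
  also have "(inv_sqrt (1 / n))\<^sup>2 = n" using n by (rule inv_sqrt_inverse)
  also have "trace (?\<sigma> ** ?T ** ?\<sigma> ** ?T) = (1 / n)\<^sup>2 *\<^sub>R (trace \<rho>
      + trace (\<rho> ** (mat 1 \<otimes>\<^sub>k S) ** \<rho> ** (mat 1 \<otimes>\<^sub>k S)))"
    unfolding trace_post_meas_state[OF full mubs register] n_def
    by (simp add: S_def trace_marginal[OF psdB] trace_ptrace)
  \<comment> \<open>The two inverse square roots of the scaled marginal contribute \<open>n\<close>
    and the two copies of the state \<open>(1 / n)\<^sup>2\<close>, leaving
    \<open>1 / n\<close>.\<close>
  also have "Re (n *\<^sub>R \<dots>) = (t + Re (trace \<rho>)) / n"
    using n by (simp add: t_def power2_eq_square field_simps)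
  also have "- log 2 \<dots> = log 2 n - log 2 (t + Re (trace \<rho>))"
    using n t tr by (simp add: log_divide)
  finally have "cond_entropy2 ?\<sigma> = log 2 n - log 2 (2 powr (- cond_entropy2 \<rho>) + Re (trace \<rho>))"
    using t by (simp add: H)
  then show ?thesis by (simp add: n_def)
qed

end
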